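(* Let $d\ge1$ and $\boldsymbol\rho=(\rho_1,\dots,\rho_d)\in B_d$. The matrix $\mathcal H_{\boldsymbol\rho}$ defines a bounded operator on $\ell^2(\mathbb N_0^d)$. Moreover, \[ \|\mathcal H_{\boldsymbol\rho}\|\le\frac{2}{1+\sqrt{1-R_{\boldsymbol\rho}^2}},\qquad R_{\boldsymbol\rho}=\rho_1+\cdots+\rho_d . \]
   Context: $B_d=\{\boldsymbol\rho=(\rho_1,\dots,\rho_d)\in[0,1]^d:\rho_1+\cdots+\rho_d\le1\}$. For $\alpha\in\mathbb N_0^d$, $|\alpha|=\sum_j\alpha_j$ and $\alpha!=\prod_j\alpha_j!$; $0^0=1$. The matrix $\mathcal H_{\boldsymbol\rho}=((\mathcal H_{\boldsymbol\rho})_{\alpha,\beta})_{\alpha,\beta\in\mathbb N_0^d}$ has entries \[ (\mathcal H_{\boldsymbol\rho})_{\alpha,\beta}=(-1)^{|\alpha|+|\beta|}\frac{(|\alpha|+|\beta|)!}{\alpha!\,\beta!}\prod_{j=1}^d\left(\frac{\rho_j}{2}\right)^{\alpha_j+\beta_j}. \] *)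

theory Defs
  imports "HOL-Analysis.Analysis"
begin

section \<open>The Hilbert space of square-summable complex families\<close>

lemma square_sum_add_bound:
  fixes x y :: "'a \<Rightarrow> complex"
  assumes x: "(\<lambda>i. (norm (x i))\<^sup>2) summable_on UNIV"
    and y: "(\<lambda>i. (norm (y i))\<^sup>2) summable_on UNIV"
    and F: "finite F"
  shows "(\<Sum>i\<in>F. (norm (x i + y i))\<^sup>2)
    \<le> (sqrt (\<Sum>\<^sub>\<infinity>i. (norm (x i))\<^sup>2) + sqrt (\<Sum>\<^sub>\<infinity>i. (norm (y i))\<^sup>2))\<^sup>2"
proof -
  have part: "L2_set (\<lambda>i. norm (z i)) F \<le> sqrt (\<Sum>\<^sub>\<infinity>i. (norm (z i))\<^sup>2)"
    if "(\<lambda>i. (norm (z i))\<^sup>2) summable_on UNIV" for z :: "'a \<Rightarrow> complex"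
    unfolding L2_set_def using that F by (auto intro!: finite_sum_le_infsum)
  have "L2_set (\<lambda>i. norm (x i + y i)) F \<le> L2_set (\<lambda>i. norm (x i) + norm (y i)) F"
    by (rule L2_set_mono) (auto intro: norm_triangle_ineq)
  also have "\<dots> \<le> L2_set (\<lambda>i. norm (x i)) F + L2_set (\<lambda>i. norm (y i)) F"
    by (rule L2_set_triangle_ineq)
  also have "\<dots> \<le> sqrt (\<Sum>\<^sub>\<infinity>i. (norm (x i))\<^sup>2) + sqrt (\<Sum>\<^sub>\<infinity>i. (norm (y i))\<^sup>2)"
    using part[OF x] part[OF y] by simp
  finally have "(L2_set (\<lambda>i. norm (x i + y i)) F)\<^sup>2
      \<le> (sqrt (\<Sum>\<^sub>\<infinity>i. (norm (x i))\<^sup>2) + sqrt (\<Sum>\<^sub>\<infinity>i. (norm (y i))\<^sup>2))\<^sup>2"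
    by (rule power_mono) simp
  then show ?thesis
    by (simp add: L2_set_def sum_nonneg)
qed

lemma square_summable_add:
  fixes x y :: "'a \<Rightarrow> complex"
  assumes "(\<lambda>i. (norm (x i))\<^sup>2) summable_on UNIV"
    and "(\<lambda>i. (norm (y i))\<^sup>2) summable_on UNIV"
  shows "(\<lambda>i. (norm (x i + y i))\<^sup>2) summable_on UNIV"
proof (rule nonneg_bdd_above_summable_on)
  show "bdd_above (sum (\<lambda>i. (norm (x i + y i))\<^sup>2) ` {F. F \<subseteq> UNIV \<and> finite F})"
    using square_sum_add_bound[OF assms] by (intro bdd_aboveI2) blast
qed simp

typedef 'a ell2 = "{x :: 'a \<Rightarrow> complex. (\<lambda>i. (norm (x i))\<^sup>2) summable_on UNIV}"
  morphisms ell2_coord Abs_ell2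
  by (rule exI[of _ "\<lambda>_. 0"]) simp

lemma ell2_coord_square_summable: "(\<lambda>i. (norm (ell2_coord x i))\<^sup>2) summable_on UNIV"
  using ell2_coord[of x] by simp

lemma ell2_eqI: "(\<And>i. ell2_coord x i = ell2_coord y i) \<Longrightarrow> x = y"
  by (rule iffD1[OF ell2_coord_inject]) (rule ext)

instantiation ell2 :: (type) real_vector
begin

definition zero_ell2 :: "'a ell2" where
  "0 = Abs_ell2 (\<lambda>_. 0)"

definition plus_ell2 :: "'a ell2 \<Rightarrow> 'a ell2 \<Rightarrow> 'a ell2" where
  "x + y = Abs_ell2 (\<lambda>i. ell2_coord x i + ell2_coord y i)"

definition scaleR_ell2 :: "real \<Rightarrow> 'a ell2 \<Rightarrow> 'a ell2" where
  "c *\<^sub>R x = Abs_ell2 (\<lambda>i. c *\<^sub>R ell2_coord x i)" for x :: "'a ell2"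

definition uminus_ell2 :: "'a ell2 \<Rightarrow> 'a ell2" where
  "- x = Abs_ell2 (\<lambda>i. - ell2_coord x i)" for x :: "'a ell2"

definition minus_ell2 :: "'a ell2 \<Rightarrow> 'a ell2 \<Rightarrow> 'a ell2" where
  "x - y = Abs_ell2 (\<lambda>i. ell2_coord x i - ell2_coord y i)" for x y :: "'a ell2"

lemma ell2_coord_zero_aux: "ell2_coord (0 :: 'a ell2) i = 0"
  unfolding zero_ell2_def by (subst Abs_ell2_inverse) auto

lemma ell2_coord_plus_aux: "ell2_coord (x + y :: 'a ell2) i = ell2_coord x i + ell2_coord y i"
  unfolding plus_ell2_def
  by (subst Abs_ell2_inverse)
    (auto intro!: square_summable_add ell2_coord_square_summable)

lemma ell2_coord_scaleR_aux: "ell2_coord (c *\<^sub>R x :: 'a ell2) i = c *\<^sub>R ell2_coord x i"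
proof -
  have "(\<lambda>i. c\<^sup>2 * (norm (ell2_coord x i))\<^sup>2) summable_on UNIV"
    by (rule summable_on_cmult_right) (rule ell2_coord_square_summable)
  then show ?thesis
    unfolding scaleR_ell2_def by (subst Abs_ell2_inverse) (simp_all add: power_mult_distrib)
qed

lemma ell2_coord_uminus_aux: "ell2_coord (- x :: 'a ell2) i = - ell2_coord x i"
  unfolding uminus_ell2_def
  by (subst Abs_ell2_inverse) (auto intro: ell2_coord_square_summable)

instance
proof
  fix x y z :: "'a ell2" and a b :: real
  show "x + y + z = x + (y + z)"
    by (rule ell2_eqI) (simp add: ell2_coord_plus_aux)
  show "x + y = y + x"
    by (rule ell2_eqI) (simp add: ell2_coord_plus_aux)
  show "0 + x = x"
    by (rule ell2_eqI) (simp add: ell2_coord_plus_aux ell2_coord_zero_aux)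
  show "- x + x = 0"
    by (rule ell2_eqI) (simp add: ell2_coord_uminus_aux ell2_coord_plus_aux ell2_coord_zero_aux)
  show "x - y = x + - y"
    by (simp add: minus_ell2_def plus_ell2_def ell2_coord_uminus_aux)
  show "a *\<^sub>R (x + y) = a *\<^sub>R x + a *\<^sub>R y"
    by (rule ell2_eqI) (simp add: ell2_coord_plus_aux ell2_coord_scaleR_aux scaleR_add_right)
  show "(a + b) *\<^sub>R x = a *\<^sub>R x + b *\<^sub>R x"
    by (rule ell2_eqI) (simp add: ell2_coord_plus_aux ell2_coord_scaleR_aux scaleR_add_left)
  show "a *\<^sub>R b *\<^sub>R x = (a * b) *\<^sub>R x"
    by (rule ell2_eqI) (simp add: ell2_coord_scaleR_aux)
  show "1 *\<^sub>R x = x"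
    by (rule ell2_eqI) (simp add: ell2_coord_scaleR_aux)
qed

end

lemma ell2_coord_zero [simp]: "ell2_coord 0 i = 0"
  by (rule ell2_coord_zero_aux)

lemma ell2_coord_plus [simp]: "ell2_coord (x + y) i = ell2_coord x i + ell2_coord y i"
  by (rule ell2_coord_plus_aux)

lemma ell2_coord_scaleR [simp]: "ell2_coord (c *\<^sub>R x) i = c *\<^sub>R ell2_coord x i"
  by (rule ell2_coord_scaleR_aux)

lemma ell2_coord_uminus [simp]: "ell2_coord (- x) i = - ell2_coord x i"
  by (rule ell2_coord_uminus_aux)

lemma ell2_coord_minus [simp]: "ell2_coord (x - y) i = ell2_coord x i - ell2_coord y i"
  using ell2_coord_plus[of x "- y" i] by simp

instantiation ell2 :: (type) real_normed_vector
begin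

definition norm_ell2 :: "'a ell2 \<Rightarrow> real" where
  "norm x = sqrt (\<Sum>\<^sub>\<infinity>i. (norm (ell2_coord x i))\<^sup>2)"

definition dist_ell2 :: "'a ell2 \<Rightarrow> 'a ell2 \<Rightarrow> real" where
  "dist x y = norm (x - y)" for x y :: "'a ell2"

definition sgn_ell2 :: "'a ell2 \<Rightarrow> 'a ell2" where
  "sgn x = inverse (norm x) *\<^sub>R x" for x :: "'a ell2"

definition uniformity_ell2 :: "('a ell2 \<times> 'a ell2) filter" where
  "uniformity_ell2 = (INF e\<in>{0 <..}. principal {(x, y). dist x y < e})"

definition open_ell2 :: "'a ell2 set \<Rightarrow> bool" where
  "open_ell2 U \<longleftrightarrow> (\<forall>x\<in>U. eventually (\<lambda>(x', y). x' = x \<longrightarrow> y \<in> U) uniformity)"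

instance
proof
  fix x y :: "'a ell2" and c :: real
  show "dist x y = norm (x - y)" by (fact dist_ell2_def)
  show "sgn x = x /\<^sub>R norm x" by (fact sgn_ell2_def)
  show "(uniformity :: ('a ell2 \<times> 'a ell2) filter)
      = (INF e\<in>{0 <..}. principal {(x, y). dist x y < e})"
    by (fact uniformity_ell2_def)
  show "open U = (\<forall>x\<in>U. \<forall>\<^sub>F (x', y) in uniformity. x' = x \<longrightarrow> y \<in> U)" for U :: "'a ell2 set"
    by (fact open_ell2_def)
  show "norm x = 0 \<longleftrightarrow> x = 0"
  proof
    assume "norm x = 0"
    then have z: "(\<Sum>\<^sub>\<infinity>i. (norm (ell2_coord x i))\<^sup>2) = 0"
      by (simp add: norm_ell2_def)
    show "x = 0"
    proof (rule ell2_eqI)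
      fix i
      have "(\<Sum>j\<in>{i}. (norm (ell2_coord x j))\<^sup>2) \<le> (\<Sum>\<^sub>\<infinity>j. (norm (ell2_coord x j))\<^sup>2)"
        by (rule finite_sum_le_infsum) (auto simp: ell2_coord_square_summable)
      then show "ell2_coord x i = ell2_coord 0 i"
        using z by simp
    qed
  qed (simp add: norm_ell2_def)
  show "norm (x + y) \<le> norm x + norm y"
  proof -
    have "(\<Sum>\<^sub>\<infinity>i. (norm (ell2_coord x i + ell2_coord y i))\<^sup>2) \<le> (norm x + norm y)\<^sup>2"
      unfolding norm_ell2_def
      by (rule infsum_le_finite_sums)
        (auto intro!: square_summable_add square_sum_add_bound ell2_coord_square_summable)
    then show ?thesis
      unfolding norm_ell2_def[of "x + y"]
      by (simp add: real_le_lsqrt norm_ell2_def infsum_nonneg)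
  qed
  show "norm (c *\<^sub>R x) = \<bar>c\<bar> * norm x"
    by (simp add: norm_ell2_def power_mult_distrib infsum_cmult_right' real_sqrt_mult)
qed

end

text \<open>
  An infinite matrix defines the operator \<open>T\<close> if every entry of the product \<open>A x\<close> converges
  (unconditionally) to the corresponding coordinate of \<open>T x\<close>, for every square-summable \<open>x\<close>.
  This determines \<open>T\<close> uniquely.
\<close>

definition matrix_defines :: "('a \<Rightarrow> 'a \<Rightarrow> real) \<Rightarrow> ('a ell2 \<Rightarrow> 'a ell2) \<Rightarrow> bool" where
  "matrix_defines A T \<longleftrightarrow>
    (\<forall>x i. ((\<lambda>j. complex_of_real (A i j) * ell2_coord x j) has_sum ell2_coord (T x) i) UNIV)"


section \<open>The matrix\<close>

text \<open>
  The dimension is \<open>d = CARD('d)\<close>, which is at least \<open>1\<close>; multi-indices are functions \<open>'d \<Rightarrow> nat\<close>.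
\<close>

definition B_set :: "(real ^ 'd) set" where
  "B_set = {\<rho>. (\<forall>j. \<rho> $ j \<in> {0..1}) \<and> (\<Sum>j\<in>UNIV. \<rho> $ j) \<le> 1}"

definition mi_abs :: "('d::finite \<Rightarrow> nat) \<Rightarrow> nat" where
  "mi_abs \<alpha> = (\<Sum>j\<in>UNIV. \<alpha> j)"

definition mi_fact :: "('d::finite \<Rightarrow> nat) \<Rightarrow> real" where
  "mi_fact \<alpha> = (\<Prod>j\<in>UNIV. fact (\<alpha> j))"

definition H_mat :: "real ^ 'd \<Rightarrow> ('d::finite \<Rightarrow> nat) \<Rightarrow> ('d \<Rightarrow> nat) \<Rightarrow> real" where
  "H_mat \<rho> \<alpha> \<beta> =
    (-1) ^ (mi_abs \<alpha> + mi_abs \<beta>) * (fact (mi_abs \<alpha> + mi_abs \<beta>) / (mi_fact \<alpha> * mi_fact \<beta>))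
      * (\<Prod>j\<in>UNIV. (\<rho> $ j / 2) ^ (\<alpha> j + \<beta> j))"

definition R_sum :: "real ^ 'd \<Rightarrow> real" where
  "R_sum \<rho> = (\<Sum>j\<in>UNIV. \<rho> $ j)"

end

theory Submission
  imports Defs
begin

text \<open>
  Put \<open>v \<alpha> = |\<alpha>|! / \<alpha>! \<cdot> \<rho>\<^sup>\<alpha>\<close>. Up to sign the entry at \<open>(\<alpha>, \<beta>)\<close> with \<open>|\<alpha>| = m\<close>, \<open>|\<beta>| = n\<close> is
  \<open>binomial (m + n) n / 2\<^bsup>m + n\<^esup> \<cdot> v \<alpha> \<cdot> v \<beta>\<close>, so the blocks of fixed degrees have rank one, and
  \<open>\<Sum>\<^bsub>|\<beta>| = n\<^esub> (v \<beta>)\<^sup>2 \<le> (\<Sum>\<^bsub>|\<beta>| = n\<^esub> v \<beta>)\<^sup>2 = R\<^bsup>2n\<^esup>\<close>. With \<open>s = sqrt (1 - R\<^sup>2)\<close> and \<open>c = 1 / (1 + s)\<close>, the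
  weights \<open>p \<beta> = c\<^bsup>|\<beta>|\<^esup> v \<beta>\<close> satisfy the Schur test with constant \<open>2 / (1 + s)\<close>, because the negative
  binomial series at \<open>c R\<^sup>2 / 2 = (1 - s) / 2\<close> sums to \<open>((1 + s) / 2)\<^bsup>-(m + 1)\<^esup>\<close>.
\<close>

section \<open>Square-summable families and the Schur test\<close>

lemma norm_ell2_square: "(norm x)\<^sup>2 = (\<Sum>\<^sub>\<infinity>i. (norm (ell2_coord x i))\<^sup>2)"
  by (simp add: norm_ell2_def infsum_nonneg)

lemma ell2_coord_Abs:
  "(\<lambda>i. (norm (y i))\<^sup>2) summable_on UNIV \<Longrightarrow> ell2_coord (Abs_ell2 y) = y"
  by (simp add: Abs_ell2_inverse)

lemma sum_squares_ell2_le: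
  assumes "finite F"
  shows "(\<Sum>i\<in>F. (norm (ell2_coord x i))\<^sup>2) \<le> (norm x)\<^sup>2"
  unfolding norm_ell2_square
  by (rule finite_sum_le_infsum) (auto simp: assms ell2_coord_square_summable)

text \<open>Weighted Cauchy-Schwarz: the weight \<open>p j\<close> is multiplied into one factor and
  divided out of the other. The row bound controls the first factor; after exchanging the sums over
  \<open>i\<close> and \<open>j\<close>, the column bound cancels the remaining
  \<open>1 / p j\<close>.\<close>

lemma schur_test_finite:
  fixes A :: "'i \<Rightarrow> 'j \<Rightarrow> real" and p :: "'j \<Rightarrow> real" and q :: "'i \<Rightarrow> real" and x :: "'j \<Rightarrow> real"
  assumes p: "\<And>j. 0 \<le> p j" and C: "0 \<le> C" and D: "0 \<le> D"
    and zero: "\<And>i j. p j = 0 \<Longrightarrow> A i j = 0"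
    and row: "\<And>i. (\<Sum>j\<in>F. \<bar>A i j\<bar> * p j) \<le> C * q i"
    and col: "\<And>j. (\<Sum>i\<in>G. \<bar>A i j\<bar> * q i) \<le> D * p j"
  shows "(\<Sum>i\<in>G. (\<Sum>j\<in>F. \<bar>A i j\<bar> * \<bar>x j\<bar>)\<^sup>2) \<le> C * D * (\<Sum>j\<in>F. (x j)\<^sup>2)"
proof -
  have "(\<Sum>j\<in>F. \<bar>A i j\<bar> * \<bar>x j\<bar>)\<^sup>2 \<le> C * q i * (\<Sum>j\<in>F. \<bar>A i j\<bar> * ((x j)\<^sup>2 / p j))" for i
  proof -
    have "\<bar>A i j\<bar> * \<bar>x j\<bar> = sqrt (\<bar>A i j\<bar> * p j) * sqrt (\<bar>A i j\<bar> * ((x j)\<^sup>2 / p j))" for j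
    \<comment> \<open>For \<open>p j = 0\<close> the quotient by \<open>p j\<close> is 0 by
      convention, and \<open>zero\<close> makes the left side vanish as well.\<close>
    proof (cases "p j = 0")
      case False
      then have "(\<bar>A i j\<bar> * p j) * (\<bar>A i j\<bar> * ((x j)\<^sup>2 / p j)) = (\<bar>A i j\<bar> * \<bar>x j\<bar>)\<^sup>2"
        by (simp add: field_simps power2_eq_square)
      then show ?thesis
        by (simp flip: real_sqrt_mult)
    qed (simp add: zero)
    then have "(\<Sum>j\<in>F. \<bar>A i j\<bar> * \<bar>x j\<bar>)\<^sup>2
        = (\<Sum>j\<in>F. sqrt (\<bar>A i j\<bar> * p j) * sqrt (\<bar>A i j\<bar> * ((x j)\<^sup>2 / p j)))\<^sup>2"
      by presburger
    also have "\<dots> \<le> (\<Sum>j\<in>F. (sqrt (\<bar>A i j\<bar> * p j))\<^sup>2)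
        * (\<Sum>j\<in>F. (sqrt (\<bar>A i j\<bar> * ((x j)\<^sup>2 / p j)))\<^sup>2)"
      by (rule Cauchy_Schwarz_ineq_sum)
    also have "\<dots> = (\<Sum>j\<in>F. \<bar>A i j\<bar> * p j) * (\<Sum>j\<in>F. \<bar>A i j\<bar> * ((x j)\<^sup>2 / p j))"
      using p by simp
    also have "\<dots> \<le> C * q i * (\<Sum>j\<in>F. \<bar>A i j\<bar> * ((x j)\<^sup>2 / p j))"
      by (rule mult_right_mono[OF row]) (simp add: p sum_nonneg)
    finally show ?thesis .
  qed
  then have "(\<Sum>i\<in>G. (\<Sum>j\<in>F. \<bar>A i j\<bar> * \<bar>x j\<bar>)\<^sup>2)
      \<le> (\<Sum>i\<in>G. C * q i * (\<Sum>j\<in>F. \<bar>A i j\<bar> * ((x j)\<^sup>2 / p j)))"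
    by (rule sum_mono)
  also have "\<dots> = (\<Sum>i\<in>G. \<Sum>j\<in>F. C * (((x j)\<^sup>2 / p j) * (\<bar>A i j\<bar> * q i)))"
    by (simp add: sum_distrib_left mult_ac)
  also have "\<dots> = (\<Sum>j\<in>F. C * (((x j)\<^sup>2 / p j) * (\<Sum>i\<in>G. \<bar>A i j\<bar> * q i)))"
    by (subst sum.swap) (simp add: sum_distrib_left)
  also have "\<dots> \<le> (\<Sum>j\<in>F. C * D * (x j)\<^sup>2)"
  proof (rule sum_mono)
    fix j
    have "((x j)\<^sup>2 / p j) * (\<Sum>i\<in>G. \<bar>A i j\<bar> * q i) \<le> D * (x j)\<^sup>2"
    proof (cases "p j = 0")
      case False
      have "((x j)\<^sup>2 / p j) * (\<Sum>i\<in>G. \<bar>A i j\<bar> * q i) \<le> ((x j)\<^sup>2 / p j) * (D * p j)"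
        by (rule mult_left_mono[OF col]) (simp add: p)
      then show ?thesis using False by (simp add: mult_ac)
    qed (simp add: D)
    then show "C * (((x j)\<^sup>2 / p j) * (\<Sum>i\<in>G. \<bar>A i j\<bar> * q i)) \<le> C * D * (x j)\<^sup>2"
      using C by (metis mult.assoc mult_left_mono)
  qed
  finally show ?thesis by (simp add: sum_distrib_left)
qed

text \<open>The finite estimate is uniform in \<open>F\<close> and \<open>G\<close>. A single row
  gives absolute convergence, the limit over \<open>F\<close> gives the bound for finitely many
  coordinates of the image, and the supremum over \<open>G\<close> gives the norm bound.\<close>

lemma schur_test:
  fixes A :: "'a \<Rightarrow> 'a \<Rightarrow> real"
  assumes p: "\<And>j. 0 \<le> p j" and C: "0 \<le> C" and D: "0 \<le> D"
    and zero: "\<And>i j. p j = 0 \<Longrightarrow> A i j = 0"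
    and row: "\<And>F i. finite F \<Longrightarrow> (\<Sum>j\<in>F. \<bar>A i j\<bar> * p j) \<le> C * q i"
    and col: "\<And>G j. finite G \<Longrightarrow> (\<Sum>i\<in>G. \<bar>A i j\<bar> * q i) \<le> D * p j"
  shows "\<exists>T. matrix_defines A T \<and> bounded_linear T \<and> onorm T \<le> sqrt (C * D)"
proof -
  let ?a = "\<lambda>x i j. complex_of_real (A i j) * ell2_coord x j"
  define S where "S x i = (\<Sum>\<^sub>\<infinity>j. ?a x i j)" for x i
  have fin: "(\<Sum>i\<in>G. (\<Sum>j\<in>F. norm (?a x i j))\<^sup>2) \<le> C * D * (norm x)\<^sup>2"
    if F: "finite F" and G: "finite G" for F G x
  proof -
    have "(\<Sum>i\<in>G. (\<Sum>j\<in>F. \<bar>A i j\<bar> * \<bar>norm (ell2_coord x j)\<bar>)\<^sup>2)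
        \<le> C * D * (\<Sum>j\<in>F. (norm (ell2_coord x j))\<^sup>2)"
      by (rule schur_test_finite[OF p C D zero row[OF F] col[OF G]])
    also have "\<dots> \<le> C * D * (norm x)\<^sup>2"
      using C D by (intro mult_left_mono sum_squares_ell2_le[OF F]) simp
    finally show ?thesis by (simp add: norm_mult)
  qed
  have S: "(?a x i has_sum S x i) UNIV" for x i
  proof -
    have "(\<Sum>j\<in>F. norm (?a x i j)) \<le> sqrt (C * D * (norm x)\<^sup>2)" if "finite F" for F
      using fin[OF that, of "{i}" x] by (intro real_le_rsqrt) simp
    then have "(\<lambda>j. norm (?a x i j)) summable_on UNIV"
      by (intro nonneg_bdd_above_summable_on bdd_aboveI2) auto
    then show ?thesis
      unfolding S_def by (rule has_sum_infsum[OF abs_summable_summable])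
  qed
  have Sfin: "(\<Sum>i\<in>G. (norm (S x i))\<^sup>2) \<le> C * D * (norm x)\<^sup>2" if G: "finite G" for G x
  proof (rule tendsto_upperbound)
    show "((\<lambda>F. \<Sum>i\<in>G. (norm (sum (?a x i) F))\<^sup>2) \<longlongrightarrow> (\<Sum>i\<in>G. (norm (S x i))\<^sup>2))
        (finite_subsets_at_top UNIV)"
      \<comment> \<open>With \<open>G\<close> fixed and finite, only finitely many convergent rows
        are involved, so the limit over \<open>F\<close> passes through the sum of squares.\<close>
      using S[where x = x] unfolding has_sum_def by (intro tendsto_intros)
    have "(\<Sum>i\<in>G. (norm (sum (?a x i) F))\<^sup>2) \<le> C * D * (norm x)\<^sup>2" if "finite F" for F
    proof -
      have "(\<Sum>i\<in>G. (norm (sum (?a x i) F))\<^sup>2) \<le> (\<Sum>i\<in>G. (\<Sum>j\<in>F. norm (?a x i j))\<^sup>2)"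
        by (intro sum_mono power_mono norm_sum) simp
      then show ?thesis using fin[OF that G, of x] by linarith
    qed
    then show "\<forall>\<^sub>F F in finite_subsets_at_top UNIV.
        (\<Sum>i\<in>G. (norm (sum (?a x i) F))\<^sup>2) \<le> C * D * (norm x)\<^sup>2"
      by (intro eventually_finite_subsets_at_top_weakI) simp
  qed simp
  define T where "T x = Abs_ell2 (S x)" for x
  have summable: "(\<lambda>i. (norm (S x i))\<^sup>2) summable_on UNIV" for x
  proof (rule nonneg_bdd_above_summable_on)
    show "bdd_above (sum (\<lambda>i. (norm (S x i))\<^sup>2) ` {F. F \<subseteq> UNIV \<and> finite F})"
      using Sfin[of _ x] by (intro bdd_aboveI2) blast
  qed simp
  have T: "ell2_coord (T x) = S x" for x
    unfolding T_def by (rule ell2_coord_Abs[OF summable])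
  have bound: "norm (T x) \<le> sqrt (C * D) * norm x" for x
  proof -
    have "(norm (T x))\<^sup>2 \<le> C * D * (norm x)\<^sup>2"
      unfolding norm_ell2_square[of "T x"]
      by (rule infsum_le_finite_sums) (auto simp: T intro: summable Sfin)
    then have "norm (T x) \<le> sqrt (C * D * (norm x)\<^sup>2)"
      by (rule real_le_rsqrt)
    then show ?thesis by (simp add: real_sqrt_mult)
  qed
  have "bounded_linear T"
  proof (rule bounded_linear_intro)
    show "T (x + y) = T x + T y" for x y
    proof (rule ell2_eqI)
      fix i
      have "(?a (x + y) i has_sum S x i + S y i) UNIV"
        using has_sum_add[OF S[of i x] S[of i y]] by (simp add: algebra_simps)
      then show "ell2_coord (T (x + y)) i = ell2_coord (T x + T y) i"
        using S[of i "x + y"] by (simp add: T has_sum_unique)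
    qed
    show "T (r *\<^sub>R x) = r *\<^sub>R T x" for r x
    proof (rule ell2_eqI)
      fix i
      have "(?a (r *\<^sub>R x) i has_sum r *\<^sub>R S x i) UNIV"
        using has_sum_cmult_right[OF S[of i x], of "of_real r"]
        by (simp add: scaleR_conv_of_real mult_ac)
      then show "ell2_coord (T (r *\<^sub>R x)) i = ell2_coord (r *\<^sub>R T x) i"
        using S[of i "r *\<^sub>R x"] by (simp add: T has_sum_unique)
    qed
    show "norm (T x) \<le> norm x * sqrt (C * D)" for x
      using bound[of x] by (simp add: mult.commute)
  qed
  moreover have "matrix_defines A T"
    using S by (simp add: matrix_defines_def T)
  moreover have "onorm T \<le> sqrt (C * D)"
    by (rule onorm_bound) (use C D bound in auto)
  ultimately show ?thesis by blast
qed

section \<open>Partial sums of the negative binomial series\<close>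

lemma sum_negative_binomial_step:
  fixes z :: real
  shows "(1 - z) * (\<Sum>n<N. real (Suc m + n choose n) * z ^ n)
    = (\<Sum>n<N. real (m + n choose n) * z ^ n) - real (m + N choose Suc m) * z ^ N"
proof (induction N)
  case (Suc N)
  \<comment> \<open>The coefficient of the new top term is also that of the new remainder. Pascal's
    rule splits it into the next term of the right-hand sum and a part that cancels the old
    remainder.\<close>
  have 1: "Suc m + N choose N = m + Suc N choose Suc m"
    using binomial_symmetric[of N "Suc m + N"] by simp
  have 2: "m + Suc N choose Suc m = (m + N choose N) + (m + N choose Suc m)"
    using binomial_symmetric[of N "m + N"] by simp
  show ?case
    unfolding sum.lessThan_Suc distrib_left Suc.IH 1
    by (simp add: 2 algebra_simps del: binomial_Suc_Suc add_Suc_right)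
qed simp

text \<open>The remainder in \<open>sum_negative_binomial_step\<close> is nonnegative, so raising
  \<open>m\<close> by one costs at most a factor \<open>1 / (1 - z)\<close>; the case
  \<open>m = 0\<close> is the geometric sum.\<close>

lemma sum_negative_binomial_le:
  fixes z :: real
  assumes "0 \<le> z" "z < 1"
  shows "(\<Sum>n<N. real (m + n choose n) * z ^ n) \<le> 1 / (1 - z) ^ Suc m"
proof (induction m)
  case 0
  have "(1 - z) * (\<Sum>n<N. z ^ n) = 1 - z ^ N"
    by (simp add: one_diff_power_eq)
  also have "\<dots> \<le> 1" using assms by simp
  finally show ?case using assms by (simp add: field_simps)
next
  case (Suc m)
  have "(1 - z) * (\<Sum>n<N. real (Suc m + n choose n) * z ^ n)
      \<le> (\<Sum>n<N. real (m + n choose n) * z ^ n)"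
    unfolding sum_negative_binomial_step using assms by simp
  also note Suc.IH
  finally have "(\<Sum>n<N. real (Suc m + n choose n) * z ^ n) \<le> 1 / (1 - z) ^ Suc m / (1 - z)"
    using assms by (subst pos_le_divide_eq) (simp_all add: mult.commute)
  then show ?case by (simp add: mult.commute)
qed

section \<open>Multinomial terms of fixed degree\<close>

text \<open>The term at \<alpha> in the multinomial expansion of
  \<open>R_sum \<rho> ^ mi_abs \<alpha>\<close>.\<close>

definition mi_multinom :: "real ^ 'd \<Rightarrow> ('d::finite \<Rightarrow> nat) \<Rightarrow> real" where
  "mi_multinom \<rho> \<alpha> = fact (mi_abs \<alpha>) / mi_fact \<alpha> * (\<Prod>j\<in>UNIV. (\<rho> $ j) ^ \<alpha> j)"

lemma mi_fact_pos: "0 < mi_fact \<alpha>"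
  by (simp add: mi_fact_def prod_pos)

lemma finite_mi_abs_eq: "finite {\<alpha> :: 'd::finite \<Rightarrow> nat. mi_abs \<alpha> = n}"
proof (rule finite_subset)
  show "{\<alpha> :: 'd \<Rightarrow> nat. mi_abs \<alpha> = n} \<subseteq> (UNIV :: 'd set) \<rightarrow>\<^sub>E {..n}"
    by (auto simp: mi_abs_def intro: member_le_sum)
  show "finite ((UNIV :: 'd set) \<rightarrow>\<^sub>E {..n})"
    by (rule finite_PiE) auto
qed

lemma mi_abs_fun_upd_Suc: "mi_abs (\<alpha>(j := Suc (\<alpha> j))) = Suc (mi_abs \<alpha>)"
proof -
  have "mi_abs \<alpha> = \<alpha> j + (\<Sum>i\<in>UNIV - {j}. \<alpha> i)" for \<alpha> :: "'a \<Rightarrow> nat"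
    unfolding mi_abs_def by (rule sum.remove) auto
  from this[of \<alpha>] this[of "\<alpha>(j := Suc (\<alpha> j))"] show ?thesis by simp
qed

lemma mi_multinom_fun_upd_Suc:
  "real (Suc (\<alpha> j)) * mi_multinom \<rho> (\<alpha>(j := Suc (\<alpha> j)))
    = real (Suc (mi_abs \<alpha>)) * (\<rho> $ j * mi_multinom \<rho> \<alpha>)"
proof -
  let ?\<beta> = "\<alpha>(j := Suc (\<alpha> j))"
  have "mi_fact \<alpha> = fact (\<alpha> j) * (\<Prod>i\<in>UNIV - {j}. fact (\<alpha> i))" for \<alpha> :: "'a \<Rightarrow> nat"
    unfolding mi_fact_def by (rule prod.remove) auto
  from this[of \<alpha>] this[of ?\<beta>] have f: "mi_fact ?\<beta> = real (Suc (\<alpha> j)) * mi_fact \<alpha>"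
    by (simp add: algebra_simps)
  have "(\<Prod>i\<in>UNIV. (\<rho> $ i) ^ \<alpha> i) = (\<rho> $ j) ^ \<alpha> j * (\<Prod>i\<in>UNIV - {j}. (\<rho> $ i) ^ \<alpha> i)"
    for \<alpha> :: "'a \<Rightarrow> nat"
    by (rule prod.remove) auto
  from this[of \<alpha>] this[of ?\<beta>]
  have g: "(\<Prod>i\<in>UNIV. (\<rho> $ i) ^ ?\<beta> i) = \<rho> $ j * (\<Prod>i\<in>UNIV. (\<rho> $ i) ^ \<alpha> i)"
    by simp
  show ?thesis
    unfolding mi_multinom_def mi_abs_fun_upd_Suc f g
    by (simp add: field_simps del: of_nat_Suc)
qed

text \<open>The multinomial theorem, by induction on the degree: writing the factor
  \<open>Suc n\<close> as the sum of the components of \<beta> splits the sum into one part per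
  coordinate \<open>j\<close>, and lowering component \<open>j\<close> maps that part to degree
  \<open>n\<close>.\<close>

lemma sum_mi_multinom:
  fixes \<rho> :: "real ^ 'd::finite"
  shows "(\<Sum>\<alpha> | mi_abs \<alpha> = n. mi_multinom \<rho> \<alpha>) = R_sum \<rho> ^ n"
proof (induction n)
  case 0
  have "{\<alpha> :: 'd \<Rightarrow> nat. mi_abs \<alpha> = 0} = {\<lambda>_. 0}"
    by (auto simp: mi_abs_def)
  then show ?case by (simp add: mi_multinom_def mi_abs_def mi_fact_def)
next
  case (Suc n)
  let ?S = "\<lambda>n. {\<alpha> :: 'd \<Rightarrow> nat. mi_abs \<alpha> = n}"
  have j: "(\<Sum>\<beta>\<in>?S (Suc n). real (\<beta> j) * mi_multinom \<rho> \<beta>)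
      = real (Suc n) * (\<rho> $ j * R_sum \<rho> ^ n)" for j
  proof -
    \<comment> \<open>Indices with \<open>\<beta> j = 0\<close> contribute nothing; on the others,
      truncated subtraction of 1 is genuinely inverse to \<open>Suc\<close>.\<close>
    have "(\<Sum>\<beta>\<in>?S (Suc n). real (\<beta> j) * mi_multinom \<rho> \<beta>)
        = (\<Sum>\<beta>\<in>{\<beta> \<in> ?S (Suc n). \<beta> j \<noteq> 0}. real (\<beta> j) * mi_multinom \<rho> \<beta>)"
      by (rule sum.mono_neutral_right) (auto simp: finite_mi_abs_eq)
    also have "\<dots> = (\<Sum>\<alpha>\<in>?S n. real (Suc n) * (\<rho> $ j * mi_multinom \<rho> \<alpha>))"
    proof (rule sum.reindex_bij_witness[where i = "\<lambda>\<alpha>. \<alpha>(j := Suc (\<alpha> j))"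
            and j = "\<lambda>\<beta>. \<beta>(j := \<beta> j - 1)"])
      fix \<beta> assume \<beta>: "\<beta> \<in> {\<beta> \<in> ?S (Suc n). \<beta> j \<noteq> 0}"
      let ?\<alpha> = "\<beta>(j := \<beta> j - 1)"
      show up: "?\<alpha>(j := Suc (?\<alpha> j)) = \<beta>"
        using \<beta> by (auto simp: fun_eq_iff)
      have abs: "mi_abs ?\<alpha> = n"
        using mi_abs_fun_upd_Suc[of ?\<alpha> j] \<beta> unfolding up by simp
      then show "?\<alpha> \<in> ?S n" by simp
      show "real (Suc n) * (\<rho> $ j * mi_multinom \<rho> ?\<alpha>) = real (\<beta> j) * mi_multinom \<rho> \<beta>"
        using mi_multinom_fun_upd_Suc[of ?\<alpha> j \<rho>] \<beta> unfolding up abs by simp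
    qed (auto simp: mi_abs_fun_upd_Suc)
    also have "\<dots> = real (Suc n) * (\<rho> $ j * R_sum \<rho> ^ n)"
      by (simp add: Suc.IH flip: sum_distrib_left)
    finally show ?thesis .
  qed
  have "real (Suc n) * (\<Sum>\<beta>\<in>?S (Suc n). mi_multinom \<rho> \<beta>)
      = (\<Sum>\<beta>\<in>?S (Suc n). \<Sum>j\<in>UNIV. real (\<beta> j) * mi_multinom \<rho> \<beta>)"
    unfolding sum_distrib_left
  proof (rule sum.cong)
    fix \<beta> assume "\<beta> \<in> ?S (Suc n)"
    then have "real (Suc n) = (\<Sum>j\<in>UNIV. real (\<beta> j))"
      unfolding mi_abs_def by (simp flip: of_nat_sum)
    then show "real (Suc n) * mi_multinom \<rho> \<beta> = (\<Sum>j\<in>UNIV. real (\<beta> j) * mi_multinom \<rho> \<beta>)"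
      by (simp add: sum_distrib_right)
  qed simp
  also have "\<dots> = (\<Sum>j\<in>UNIV. real (Suc n) * (\<rho> $ j * R_sum \<rho> ^ n))"
    by (subst sum.swap) (simp only: j)
  also have "\<dots> = real (Suc n) * R_sum \<rho> ^ Suc n"
    unfolding R_sum_def[of \<rho>] by (simp add: sum_distrib_left sum_distrib_right)
  finally show ?case by (simp del: of_nat_Suc)
qed

text \<open>By nonnegativity each term is at most the full sum, so one factor of each square can be
  replaced by that sum.\<close>

lemma sum_mi_multinom_square_le:
  fixes \<rho> :: "real ^ 'd::finite"
  assumes "\<And>j. 0 \<le> \<rho> $ j"
  shows "(\<Sum>\<alpha> | mi_abs \<alpha> = n. (mi_multinom \<rho> \<alpha>)\<^sup>2) \<le> (R_sum \<rho>)\<^sup>2 ^ n"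
proof -
  have nonneg: "0 \<le> mi_multinom \<rho> \<alpha>" for \<alpha>
    using assms by (simp add: mi_multinom_def prod_nonneg less_imp_le[OF mi_fact_pos])
  have "(\<Sum>\<alpha> | mi_abs \<alpha> = n. (mi_multinom \<rho> \<alpha>)\<^sup>2)
      \<le> (\<Sum>\<alpha> | mi_abs \<alpha> = n. mi_multinom \<rho> \<alpha> * (\<Sum>\<beta> | mi_abs \<beta> = n. mi_multinom \<rho> \<beta>))"
    unfolding power2_eq_square
    by (intro sum_mono mult_left_mono member_le_sum) (auto simp: nonneg finite_mi_abs_eq)
  also have "\<dots> = (R_sum \<rho> ^ n) * (R_sum \<rho> ^ n)"
    by (simp add: sum_mi_multinom flip: sum_distrib_right)
  finally show ?thesis
    by (simp add: power2_eq_square power_mult_distrib)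
qed

section \<open>The Schur test applied to \<open>H_mat\<close>\<close>

lemma abs_H_mat:
  fixes \<rho> :: "real ^ 'd::finite"
  assumes "\<And>j. 0 \<le> \<rho> $ j"
  shows "\<bar>H_mat \<rho> \<alpha> \<beta>\<bar> = real (mi_abs \<alpha> + mi_abs \<beta> choose mi_abs \<beta>)
    / 2 ^ (mi_abs \<alpha> + mi_abs \<beta>) * mi_multinom \<rho> \<alpha> * mi_multinom \<rho> \<beta>"
proof -
  have "(\<Prod>j\<in>UNIV. (\<rho> $ j / 2) ^ (\<alpha> j + \<beta> j))
      = (\<Prod>j\<in>UNIV. (\<rho> $ j) ^ \<alpha> j) * (\<Prod>j\<in>UNIV. (\<rho> $ j) ^ \<beta> j) / 2 ^ (mi_abs \<alpha> + mi_abs \<beta>)"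
    by (simp add: power_divide power_add prod_dividef prod.distrib mi_abs_def power_sum)
  moreover have "fact (mi_abs \<alpha> + mi_abs \<beta>) = real (mi_abs \<alpha> + mi_abs \<beta> choose mi_abs \<beta>)
      * fact (mi_abs \<alpha>) * fact (mi_abs \<beta>)"
    by (simp add: binomial_fact)
  moreover have "0 \<le> (\<Prod>j\<in>UNIV. (\<rho> $ j) ^ \<alpha> j)" for \<alpha> :: "'d \<Rightarrow> nat"
    using assms by (simp add: prod_nonneg)
  ultimately show ?thesis
    by (simp add: H_mat_def mi_multinom_def abs_mult power_abs abs_of_pos[OF mi_fact_pos] mult_ac)
qed

lemma H_mat_commute: "H_mat \<rho> \<alpha> \<beta> = H_mat \<rho> \<beta> \<alpha>"
  by (simp add: H_mat_def add.commute mult.commute)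

theorem lemma3p3:
  fixes \<rho> :: "real ^ 'd::finite"
  assumes "\<rho> \<in> B_set"
  shows "\<exists>T :: ('d \<Rightarrow> nat) ell2 \<Rightarrow> ('d \<Rightarrow> nat) ell2.
    matrix_defines (H_mat \<rho>) T \<and> bounded_linear T \<and>
    onorm T \<le> 2 / (1 + sqrt (1 - (R_sum \<rho>)\<^sup>2))"
proof -
  define s where "s = sqrt (1 - (R_sum \<rho>)\<^sup>2)"
  define L where "L = 2 / (1 + s)"
  define v where "v = mi_multinom \<rho>"
  \<comment> \<open>With \<open>R = R_sum \<rho>\<close>, the ratio \<open>c = 1 / (1 + s)\<close>
    is a root of \<open>R^2 * c^2 - 2 * c + 1 = 0\<close>. This is the condition
    \<open>1 / (2 - c * R^2) = c\<close> under which the row estimate reproduces the geometric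
    weight \<open>c ^ m\<close>.\<close>
  define p where "p \<alpha> = (1 / (1 + s)) ^ mi_abs \<alpha> * v \<alpha>" for \<alpha>
  have \<rho>: "0 \<le> \<rho> $ j" for j
    using assms by (simp add: B_set_def)
  have R: "0 \<le> R_sum \<rho>" "R_sum \<rho> \<le> 1"
    using assms \<rho> by (simp_all add: B_set_def R_sum_def sum_nonneg)
  then have "(R_sum \<rho>)\<^sup>2 \<le> 1" by (simp add: power_le_one)
  then have s: "0 \<le> s" "s\<^sup>2 = 1 - (R_sum \<rho>)\<^sup>2" "s \<le> 1"
    by (simp_all add: s_def)
  have v: "0 \<le> v \<alpha>" for \<alpha>
    using \<rho> by (simp add: v_def mi_multinom_def prod_nonneg less_imp_le[OF mi_fact_pos])
  have row: "(\<Sum>\<beta>\<in>F. \<bar>H_mat \<rho> \<alpha> \<beta>\<bar> * p \<beta>) \<le> L * p \<alpha>" if F: "finite F" for F \<alpha>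
  proof -
    let ?m = "mi_abs \<alpha>"
    obtain N where N: "mi_abs ` F \<subseteq> {..<N}"
      using F finite_nat_iff_bounded by blast
    \<comment> \<open>Uses \<open>R^2 = (1 - s) * (1 + s)\<close>.\<close>
    have z: "1 / (1 + s) * (R_sum \<rho>)\<^sup>2 / 2 = (1 - s) / 2"
      using s by (simp add: field_simps power2_eq_square)
    have block: "(\<Sum>\<beta> | mi_abs \<beta> = n. \<bar>H_mat \<rho> \<alpha> \<beta>\<bar> * p \<beta>)
        \<le> v \<alpha> / 2 ^ ?m * (real (?m + n choose n) * ((1 - s) / 2) ^ n)" for n
    proof -
      \<comment> \<open>\<open>?k\<close> collects all that is constant on the block;
        \<open>v \<beta>\<close> occurs twice, once from the entry and once from the weight.\<close>
      let ?k = "v \<alpha> * real (?m + n choose n) / 2 ^ (?m + n) * (1 / (1 + s)) ^ n"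
      have "(\<Sum>\<beta> | mi_abs \<beta> = n. \<bar>H_mat \<rho> \<alpha> \<beta>\<bar> * p \<beta>) = (\<Sum>\<beta> | mi_abs \<beta> = n. ?k * (v \<beta>)\<^sup>2)"
        by (rule sum.cong) (auto simp: abs_H_mat[OF \<rho>] p_def v_def power2_eq_square)
      also have "\<dots> \<le> ?k * (R_sum \<rho>)\<^sup>2 ^ n"
        unfolding sum_distrib_left[symmetric]
        using sum_mi_multinom_square_le[OF \<rho>] v s by (intro mult_left_mono) (auto simp: v_def)
      also have "\<dots> = v \<alpha> / 2 ^ ?m * (real (?m + n choose n)
          * (1 / (1 + s) * (R_sum \<rho>)\<^sup>2 / 2) ^ n)"
        unfolding power_add power_mult_distrib power_divide by (simp add: mult_ac)
      finally show ?thesis unfolding z .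
    qed
    \<comment> \<open>The summands are nonnegative, so \<open>F\<close> may be enlarged to all
      multi-indices of degree below \<open>N\<close> and then cut into degree blocks.\<close>
    have "(\<Sum>\<beta>\<in>F. \<bar>H_mat \<rho> \<alpha> \<beta>\<bar> * p \<beta>)
        \<le> (\<Sum>\<beta>\<in>(\<Union>n<N. {\<beta>. mi_abs \<beta> = n}). \<bar>H_mat \<rho> \<alpha> \<beta>\<bar> * p \<beta>)"
      using N s v by (intro sum_mono2) (auto simp: finite_mi_abs_eq p_def)
    also have "\<dots> = (\<Sum>n<N. \<Sum>\<beta> | mi_abs \<beta> = n. \<bar>H_mat \<rho> \<alpha> \<beta>\<bar> * p \<beta>)"
      by (rule sum.UNION_disjoint) (auto simp: finite_mi_abs_eq)
    also have "\<dots> \<le> (\<Sum>n<N. v \<alpha> / 2 ^ ?m * (real (?m + n choose n) * ((1 - s) / 2) ^ n))"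
      by (rule sum_mono) (rule block)
    also have "\<dots> = v \<alpha> / 2 ^ ?m * (\<Sum>n<N. real (?m + n choose n) * ((1 - s) / 2) ^ n)"
      by (simp add: sum_distrib_left)
    also have "\<dots> \<le> v \<alpha> / 2 ^ ?m * (1 / (1 - (1 - s) / 2) ^ Suc ?m)"
      using s v by (intro mult_left_mono sum_negative_binomial_le) auto
    also have "1 - (1 - s) / 2 = (1 + s) / 2"
      by (simp add: field_simps)
    \<comment> \<open>The powers of 2 cancel down to one factor 2, leaving
      \<open>2 / (1 + s) ^ Suc ?m\<close>, that is, \<open>L\<close> times the ratio to the power
      \<open>?m\<close>.\<close>
    also have "v \<alpha> / 2 ^ ?m * (1 / ((1 + s) / 2) ^ Suc ?m) = L * p \<alpha>"
      using s by (simp add: L_def p_def power_divide field_simps)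
    finally show ?thesis .
  qed
  have L: "0 \<le> L" using s by (simp add: L_def)
  \<comment> \<open>The matrix is symmetric, so the row estimate also bounds the columns, with the
    same weight and the same constant.\<close>
  have "\<exists>T. matrix_defines (H_mat \<rho>) T \<and> bounded_linear T \<and> onorm T \<le> sqrt (L * L)"
  proof (rule schur_test[where p = p and q = p])
    \<comment> \<open>Weights can vanish when some component of \<rho> is 0; the matching column of
      the matrix then vanishes too.\<close>
    show "H_mat \<rho> \<alpha> \<beta> = 0" if "p \<beta> = 0" for \<alpha> \<beta>
    proof -
      have "v \<beta> = 0" using that s by (simp add: p_def)
      then have "\<bar>H_mat \<rho> \<alpha> \<beta>\<bar> = 0" by (simp add: abs_H_mat[OF \<rho>] v_def)
      then show ?thesis by simp
    qed
    show "(\<Sum>\<alpha>\<in>G. \<bar>H_mat \<rho> \<alpha> \<beta>\<bar> * p \<alpha>) \<le> L * p \<beta>" if "finite G" for G \<beta>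
      using row[OF that, of \<beta>] by (simp add: H_mat_commute[of \<rho> _ \<beta>])
  qed (use s v L row in \<open>auto simp: p_def\<close>)
  then show ?thesis
    using L by (simp only: real_sqrt_abs2 abs_of_nonneg) (simp only: L_def s_def)
qed

end
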